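(* Let $N,L,s$ be positive integers with $s\le L$, let $\mathbf{D}\in\mathbb{R}^{N\times N}$ and $\mathbf{H}\in\mathbb{R}^{N\times L}$, and consider the discrete-time linear system $\mathbf{x}_k=\mathbf{D}\mathbf{x}_{k-1}+\mathbf{H}\mathbf{h}_k$ with state $\mathbf{x}_k\in\mathbb{R}^N$ and inputs $\mathbf{h}_k\in\mathbb{R}^L$ constrained to satisfy $\|\mathbf{h}_k\|_0\le s$. Let $R_{\mathbf{D}}=\operatorname{rank}(\mathbf{D})$. Then the system is $s$-sparse-controllable if and only if $$\operatorname{rank}\begin{bmatrix}\lambda\mathbf{I}-\mathbf{D} & \mathbf{H}\end{bmatrix}=N\ \text{ for all }\lambda\in\mathbb{C},\qquad\text{and}\qquad N\le s+R_{\mathbf{D}}.$$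
   Context: $\|\cdot\|_0$ denotes the number of nonzero entries of a vector. The system is called $s$-sparse-controllable if for every initial state $\mathbf{x}_0=\mathbf{x}_{\mathrm{init}}\in\mathbb{R}^N$ and every final state $\mathbf{x}_{\mathrm{final}}\in\mathbb{R}^N$ there exist a finite $K$ and inputs $\mathbf{h}_1,\dots,\mathbf{h}_K\in\mathbb{R}^L$ with $\|\mathbf{h}_k\|_0\le s$ for all $k$ that steer the system from $\mathbf{x}_0=\mathbf{x}_{\mathrm{init}}$ to $\mathbf{x}_K=\mathbf{x}_{\mathrm{final}}$. *)

theory Defs
  imports "HOL-Analysis.Analysis"
begin

text \<open>Number of nonzero entries of a vector (the l0 "norm").\<close>
definition l0_norm :: "real^'l \<Rightarrow> nat" where
  "l0_norm h = card {i. h $ i \<noteq> 0}"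

text \<open>State of the system x_k = D x_{k-1} + H h_k after k steps, starting at x0,
  with input sequence h (only h 1, h 2, ... are used).\<close>
fun sys_state :: "real^'n^'n \<Rightarrow> real^'l^'n \<Rightarrow> real^'n \<Rightarrow> (nat \<Rightarrow> real^'l) \<Rightarrow> nat \<Rightarrow> real^'n" where
  "sys_state D H x0 h 0 = x0"
| "sys_state D H x0 h (Suc k) = D *v sys_state D H x0 h k + H *v h (Suc k)"

definition s_sparse_controllable :: "real^'n^'n \<Rightarrow> real^'l^'n \<Rightarrow> nat \<Rightarrow> bool" where
  "s_sparse_controllable D H s \<longleftrightarrow>
     (\<forall>x_init x_final. \<exists>K h. (\<forall>k\<in>{1..K}. l0_norm (h k) \<le> s) \<and>
                              sys_state D H x_init h K = x_final)"

text \<open>The complex N x (N+L) block matrix [lambda I - D, H]; columns indexed by 'n + 'l.\<close>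
definition pbh_matrix :: "complex \<Rightarrow> real^'n^'n \<Rightarrow> real^'l^'n \<Rightarrow> complex^('n + 'l)^'n" where
  "pbh_matrix lam D H = (\<chi> i j. case j of
        Inl j' \<Rightarrow> (if i = j' then lam else 0) - complex_of_real (D $ i $ j')
      | Inr j' \<Rightarrow> complex_of_real (H $ i $ j'))"

end

theory Submission
  imports Defs "HOL-Computational_Algebra.Fundamental_Theorem_Algebra"
begin

text \<open>
  Necessity. A row vector \<open>c\<close> with \<open>c D = \<lambda> c\<close> and \<open>c H = 0\<close> annihilates every state
  reachable from \<open>0\<close>, so it vanishes; this is the PBH rank condition. Every state reachable
  in at least one step lies in \<open>range D + span {h\<^sub>j | j \<in> S}\<close> for some set \<open>S\<close> of at
  most \<open>s\<close> columns. These finitely many subspaces cover \<open>\<real>\<^sup>N\<close>, which is impossible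
  for proper subspaces (they are Lebesgue null), hence \<open>N \<le> s + rank D\<close>.

  Sufficiency. If the Krylov vectors \<open>D\<^sup>m h\<^sub>j\<close> did not span \<open>\<real>\<^sup>N\<close>, their
  complex annihilator would be a nonzero \<open>D\<^sup>T\<close>-invariant subspace, and an eigenvector in
  it would violate the PBH condition. Since \<open>range D\<close> and the columns of \<open>H\<close> span
  \<open>\<real>\<^sup>N\<close>, some \<open>s\<close> columns \<open>T\<close> already do together with \<open>range D\<close>; inductively the
  vectors \<open>D\<^sup>m h\<^sub>j\<close> (\<open>m < k\<close>, \<open>j \<in> T\<close>) span \<open>\<real>\<^sup>N\<close> together with
  \<open>range D\<^sup>k\<close>. Once \<open>range D\<^sup>k\<close> has stabilised it is spanned by the Krylov vectors
  of every tail of times, so it can be covered greedily by one Krylov vector per later time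
  slot. Choosing the inputs slot by slot in reverse time order then steers any state to any
  state.
\<close>

section \<open>Linear algebra\<close>

lemma (in module) span_image_finite_sum:
  assumes "finite P" and "y \<in> span (f ` P)"
  shows "\<exists>c. y = (\<Sum>p\<in>P. scale (c p) (f p))"
  using assms(2)
proof (induction rule: span_induct_alt)
  case base
  show ?case by (intro exI[of _ "\<lambda>_. 0"]) simp
next
  case (step a x y)
  then obtain q c where q: "q \<in> P" "x = f q" and y: "y = (\<Sum>p\<in>P. scale (c p) (f p))"
    by blast
  have "(\<Sum>p\<in>P. scale (if p = q then a else 0) (f p)) = scale a x"
    using q assms(1) by (simp add: if_distrib[of "\<lambda>r. scale r (f _)"] sum.delta' cong: if_cong)
  then have "(\<Sum>p\<in>P. scale (c p + (if p = q then a else 0)) (f p)) = scale a x + y"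
    by (simp add: y scale_left_distrib sum.distrib)
  then show ?case by metis
qed

lemma span_eq_UNIV_if_subset_span:
  assumes "span A = UNIV" and "A \<subseteq> span B"
  shows "span B = UNIV"
  using span_mono[OF assms(2)] assms(1) by (simp add: span_span top.extremum_unique)

lemma linear_funpow:
  fixes f :: "'a::real_vector \<Rightarrow> 'a"
  assumes "linear f"
  shows "linear (f ^^ n)"
proof (induction n)
  case 0
  show ?case
    unfolding funpow.simps(1) by (rule linear_id)
next
  case (Suc n)
  show ?case
    unfolding funpow.simps(2) by (rule linear_compose[OF Suc.IH assms])
qed

lemma dim_Un_le: "dim (A \<union> B) \<le> dim A + dim (B :: 'a::euclidean_space set)"
proof -
  have "dim (A \<union> B) = dim {x + y |x y. x \<in> span A \<and> y \<in> span B}"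
    by (simp only: span_Un[symmetric] dim_span)
  also have "\<dots> \<le> dim (span A) + dim (span B)"
    using dim_sums_Int[OF subspace_span subspace_span, of A B] by linarith
  finally show ?thesis by simp
qed

text \<open>A proper subspace is a Lebesgue null set.\<close>

lemma Union_lowdim_ne_UNIV:
  fixes \<S> :: "'a::euclidean_space set set"
  assumes "finite \<S>" and "\<And>S. S \<in> \<S> \<Longrightarrow> dim S < DIM('a)"
  shows "\<Union>\<S> \<noteq> UNIV"
proof
  assume "\<Union>\<S> = UNIV"
  moreover have "negligible (\<Union>\<S>)"
    using assms by (intro negligible_Union negligible_lowdim) auto
  ultimately show False
    using non_negligible_UNIV by simp
qed

lemma spanning_extension_card_le:
  fixes U G :: "'a::euclidean_space set"
  assumes "subspace U" and "span (U \<union> G) = UNIV"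
  shows "\<exists>F\<subseteq>G. finite F \<and> card F + dim U \<le> DIM('a) \<and> span (U \<union> F) = UNIV"
proof -
  obtain B where B: "B \<subseteq> U" "independent B" "U \<subseteq> span B" "card B = dim U"
    using basis_exists by blast
  obtain C where C: "B \<subseteq> C" "C \<subseteq> B \<union> G" "independent C" "B \<union> G \<subseteq> span C"
    using maximal_independent_subset_extend[of B "B \<union> G"] B(2) by blast
  have "U \<subseteq> span C"
    using B(3) span_mono[OF C(1)] by (simp add: span_span)
  then have "span C = UNIV"
    using span_eq_UNIV_if_subset_span[OF assms(2)] C(4) by blast
  then have "card C = DIM('a)"
    using dim_span_eq_card_independent[OF C(3)] by simp
  moreover have "finite C"
    using C(3) finiteI_independent by blast
  moreover have "finite B"
    using B(2) finiteI_independent by blast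
  ultimately have "card (C - B) + dim U = DIM('a)"
    using B(4) card_Diff_subset[OF _ C(1)] card_mono[OF _ C(1)] by simp
  moreover have "span (U \<union> (C - B)) = UNIV"
  proof -
    have "C \<subseteq> U \<union> (C - B)"
      using B(1) by blast
    then have "C \<subseteq> span (U \<union> (C - B))"
      by (rule order_trans[OF _ span_superset])
    then show ?thesis
      by (rule span_eq_UNIV_if_subset_span[OF \<open>span C = UNIV\<close>])
  qed
  moreover have "C - B \<subseteq> G"
    using C(2) by blast
  ultimately show ?thesis
    using \<open>finite C\<close> by (intro exI[of _ "C - B"] conjI) simp_all
qed

lemma exists_tail_vector_notin_span:
  assumes "W \<subseteq> span (g ` ({E..} \<times> UNIV))" and "\<not> W \<subseteq> span X"
  shows "\<exists>m j. E \<le> m \<and> g (m, j) \<notin> span X"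
proof (rule ccontr)
  assume "\<not> ?thesis"
  then have "g ` ({E..} \<times> UNIV) \<subseteq> span X"
    by fastforce
  then have "span (g ` ({E..} \<times> UNIV)) \<subseteq> span X"
    by (rule span_minimal) (rule subspace_span)
  then show False
    using assms by blast
qed

text \<open>Greedy extension by one vector per time slot: while \<open>W\<close> is not covered, some vector of every
  tail lies outside the current span, and adding it raises the dimension.\<close>

lemma slotwise_spanning_extension:
  fixes g :: "nat \<times> 'j \<Rightarrow> 'a::euclidean_space"
  assumes tails: "\<And>E. W \<subseteq> span (g ` ({E..} \<times> UNIV))"
  shows "\<exists>Q. finite Q \<and> fst ` Q \<subseteq> {E..} \<and> inj_on fst Q \<and> W \<subseteq> span (X \<union> g ` Q)"
proof -
  have "\<exists>Q. finite Q \<and> fst ` Q \<subseteq> {E..} \<and> inj_on fst Q \<and> W \<subseteq> span (X \<union> g ` Q)"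
    if "DIM('a) - dim X \<le> n" for n
    using that
  proof (induction n arbitrary: X E)
    case 0
    then have "dim X = DIM('a)"
      using dim_subset_UNIV[of X] by linarith
    then have "span X = UNIV"
      by (simp add: dim_eq_full)
    then show ?case by (intro exI[of _ "{}"]) auto
  next
    case (Suc n)
    show ?case
    proof (cases "W \<subseteq> span X")
      case True
      then show ?thesis by (intro exI[of _ "{}"]) auto
    next
      case False
      obtain m j where mj: "E \<le> m" "g (m, j) \<notin> span X"
        using exists_tail_vector_notin_span[OF tails False] by blast
      have "dim (insert (g (m, j)) X) = Suc (dim X)"
        using mj(2) by (simp add: dim_insert)
      then have "DIM('a) - dim (insert (g (m, j)) X) \<le> n"
        using Suc.prems by linarith
      from Suc.IH[where E = "Suc m", OF this]
      obtain Q where Q: "finite Q" "fst ` Q \<subseteq> {Suc m..}" "inj_on fst Q"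
          "W \<subseteq> span (insert (g (m, j)) X \<union> g ` Q)"
        by blast
      have "insert (g (m, j)) X \<union> g ` Q = X \<union> g ` insert (m, j) Q"
        by auto
      moreover have "m \<notin> fst ` Q"
        using Q(2) by auto
      ultimately show ?thesis
        using Q mj(1) by (intro exI[of _ "insert (m, j) Q"]) auto
    qed
  qed
  then show ?thesis by blast
qed

lemma card_slice_le_Suc0:
  fixes Q :: "('i \<times> 'j::finite) set"
  assumes "inj_on fst Q"
  shows "card {j. (m, j) \<in> Q} \<le> Suc 0"
  unfolding card_le_Suc0_iff_eq[OF finite]
proof (intro ballI)
  fix a b assume "a \<in> {j. (m, j) \<in> Q}" and "b \<in> {j. (m, j) \<in> Q}"
  then have "(m, a) = (m, b)"
    by (intro inj_onD[OF assms]) simp_all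
  then show "a = b" by simp
qed

lemma range_funpow_stabilizes:
  fixes f :: "'a::euclidean_space \<Rightarrow> 'a"
  assumes "linear f"
  shows "\<exists>k0. \<forall>k\<ge>k0. range (f ^^ k) = range (f ^^ k0)"
proof -
  obtain k0 where k0: "\<And>k. dim (range (f ^^ k0)) \<le> dim (range (f ^^ k))"
    using ex_has_least_nat[of "\<lambda>_. True" 0 "\<lambda>k. dim (range (f ^^ k))"] by blast
  have "range (f ^^ k) = range (f ^^ k0)" if "k0 \<le> k" for k
  proof (rule subspace_dim_equal)
    show "subspace (range (f ^^ k))" "subspace (range (f ^^ k0))"
      using linear_subspace_image[OF linear_funpow[OF assms] subspace_UNIV] by blast+
    have "f ^^ k = f ^^ k0 \<circ> f ^^ (k - k0)"
      using that funpow_add[of k0 "k - k0" f] by simp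
    then show "range (f ^^ k) \<subseteq> range (f ^^ k0)"
      by auto
  qed (rule k0)
  then show ?thesis by blast
qed

lemma rows_eq_image_cart_basis:
  fixes M :: "'a::field^'c^'r"
  shows "rows M = (*v) (transpose M) ` cart_basis"
proof -
  have axis_row: "transpose M *v axis i 1 = row i M" for i
    by (simp add: vector_matrix_mult_def row_def axis_def vec_eq_iff
        if_distrib[of "\<lambda>x. x * y" for y] cong: if_cong)
  have basis: "cart_basis = range (\<lambda>i. axis i (1::'a))"
    by (auto simp: cart_basis_def)
  have "rows M = range (\<lambda>i. row i M)"
    by (auto simp: rows_def)
  also have "\<dots> = (*v) (transpose M) ` cart_basis"
    by (simp only: basis image_image axis_row)
  finally show ?thesis .
qed

lemma rank_eq_card_rows_iff:
  fixes M :: "'a::field^'c^'r"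
  shows "rank M = CARD('r) \<longleftrightarrow> (\<forall>c. c v* M = 0 \<longrightarrow> c = 0)"
proof -
  let ?L = "(*v) (transpose M)"
  note rows = rows_eq_image_cart_basis[of M]
  have dim_basis: "vec.dim (cart_basis :: ('a^'r) set) = CARD('r)"
    by (simp add: vec.dim_eq_card_independent independent_cart_basis card_cart_basis)
  show ?thesis
  proof
    assume rank: "rank M = CARD('r)"
    have "card (rows M) \<le> CARD('r)"
      unfolding rows using card_image_le[OF finite_cart_basis, of ?L] by (simp add: card_cart_basis)
    moreover have "rank M \<le> card (rows M)"
      unfolding row_rank_def_gen rows by (rule vec.dim_le_card') (simp add: finite_cart_basis)
    ultimately have card_rows: "card (?L ` cart_basis) = card (cart_basis :: ('a^'r) set)"
      using rank by (simp add: rows card_cart_basis)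
    have "vec.independent (?L ` cart_basis)"
      using rank card_rows
      by (intro vec.card_le_dim_spanning[OF order_refl vec.span_superset])
         (simp_all add: finite_cart_basis row_rank_def_gen rows card_cart_basis)
    moreover have "inj_on ?L cart_basis"
      using card_rows by (simp add: eq_card_imp_inj_on finite_cart_basis)
    ultimately have "inj ?L"
      using vec.inj_on_span_independent_image[of "transpose M" cart_basis] by simp
    then show "\<forall>c. c v* M = 0 \<longrightarrow> c = 0"
      by (simp add: vec.inj_iff_eq_0)
  next
    assume "\<forall>c. c v* M = 0 \<longrightarrow> c = 0"
    then have "inj ?L"
      by (simp add: vec.inj_iff_eq_0)
    then have "vec.dim (?L ` cart_basis) = vec.dim (cart_basis :: ('a^'r) set)"
      by (intro vec.dim_image_eq) (auto intro: inj_on_subset)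
    then show "rank M = CARD('r)"
      by (simp add: row_rank_def_gen rows dim_basis)
  qed
qed

section \<open>Eigenvectors in invariant subspaces\<close>

text \<open>\<open>poly_act p A u\<close> is \<open>p(A) u\<close>, computed by Horner's scheme.\<close>

definition poly_act :: "'a::field poly \<Rightarrow> 'a^'n^'n \<Rightarrow> 'a^'n \<Rightarrow> 'a^'n" where
  "poly_act p A u = fold_coeffs (\<lambda>a v. a *s u + A *v v) p 0"

lemma poly_act_0 [simp]: "poly_act 0 A u = 0"
  by (simp add: poly_act_def)

lemma poly_act_pCons [simp]: "poly_act (pCons a p) A u = a *s u + A *v poly_act p A u"
  by (cases "p = 0 \<and> a = 0") (auto simp: poly_act_def)

lemma poly_act_add: "poly_act (p + q) A u = poly_act p A u + poly_act q A u"
  by (induction p q rule: poly_induct2) (simp_all add: algebra_simps vector_sadd_rdistrib)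

lemma poly_act_smult: "poly_act (smult c p) A u = c *s poly_act p A u"
  by (induction p) (simp_all add: vector_scalar_commute vector_add_ldistrib vector_smult_assoc)

lemma poly_act_diff: "poly_act (p - q) A u = poly_act p A u - poly_act q A u"
  by (metis poly_act_add add_diff_cancel_right' diff_add_cancel)

lemma poly_act_sum: "poly_act (\<Sum>i\<in>I. p i) A u = (\<Sum>i\<in>I. poly_act (p i) A u)"
  by (induction I rule: infinite_finite_induct) (simp_all add: poly_act_add)

lemma poly_act_monom: "poly_act (monom a k) A u = a *s ((*v) A ^^ k) u"
  by (induction k) (simp_all add: monom_0 monom_Suc vector_scalar_commute)

lemma poly_act_linear_factor:
  "poly_act ([:-\<mu>, 1:] * q) A u = A *v poly_act q A u - \<mu> *s poly_act q A u"
  by (simp add: poly_act_diff poly_act_smult vec_eq_iff)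

lemma poly_act_in_invariant_subspace:
  assumes "vec.subspace W" and "\<And>w. w \<in> W \<Longrightarrow> A *v w \<in> W" and "u \<in> W"
  shows "poly_act p A u \<in> W"
  by (induction p) (use assms in \<open>simp_all add: vec.subspace_add vec.subspace_scale vec.subspace_0\<close>)

lemma exists_annihilating_poly:
  fixes A :: "'a::field^'n^'n"
  shows "\<exists>p. p \<noteq> 0 \<and> poly_act p A u = 0"
proof (rule ccontr)
  assume none: "\<nexists>p. p \<noteq> 0 \<and> poly_act p A u = 0"
  define w where "w i = ((*v) A ^^ i) u" for i
  have new: "w k \<notin> vec.span (w ` {..<k})" for k
  proof
    assume "w k \<in> vec.span (w ` {..<k})"
    then obtain c where c: "w k = (\<Sum>i<k. c i *s w i)"
      using vec.span_image_finite_sum[of "{..<k}"] by blast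
    define p where "p = monom 1 k - (\<Sum>i<k. monom (c i) i)"
    have "coeff p k = 1"
      by (simp add: p_def coeff_sum)
    then have "p \<noteq> 0"
      by auto
    moreover have "poly_act p A u = w k - (\<Sum>i<k. c i *s w i)"
      by (simp add: p_def poly_act_diff poly_act_sum poly_act_monom w_def)
    then have "poly_act p A u = 0"
      using c by simp
    ultimately show False
      using none by blast
  qed
  have "vec.dim (w ` {..<k}) = k" for k
  proof (induction k)
    case (Suc k)
    then show ?case
      using new[of k] by (simp add: lessThan_Suc vec.dim_insert)
  qed simp
  then show False
    using dim_subset_UNIV_cart_gen[of "w ` {..<Suc CARD('n)}"] by simp
qed

lemma eigenvector_of_annihilating_poly:
  fixes A :: "complex^'n^'n"
  assumes "p \<noteq> 0" and "poly_act p A u = 0" and "u \<noteq> 0"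
  shows "\<exists>q \<mu>. poly_act q A u \<noteq> 0 \<and> A *v poly_act q A u = \<mu> *s poly_act q A u"
  using assms(1,2)
proof (induction "degree p" arbitrary: p rule: less_induct)
  case less
  show ?case
  proof (cases "degree p = 0")
    case True
    then obtain a where "p = [:a:]" "a \<noteq> 0"
      using less.prems(1) by (metis degree_eq_zeroE pCons_0_0)
    then show ?thesis
      using less.prems(2) assms(3) by (simp add: vec_eq_iff)
  next
    case False
    then obtain \<mu> where "poly p \<mu> = 0"
      using alg_closed_imp_poly_has_root by blast
    then obtain q where p: "p = [:-\<mu>, 1:] * q"
      by (meson dvdE poly_eq_0_iff_dvd)
    have "q \<noteq> 0"
      using less.prems(1) p by auto
    then have "degree q < degree p"
      unfolding p by (subst degree_mult_eq) auto
    show ?thesis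
    proof (cases "poly_act q A u = 0")
      case True
      then show ?thesis
        using less.hyps[OF \<open>degree q < degree p\<close> \<open>q \<noteq> 0\<close>] by blast
    next
      case False
      moreover have "A *v poly_act q A u = \<mu> *s poly_act q A u"
        using less.prems(2) unfolding p poly_act_linear_factor by simp
      ultimately show ?thesis by blast
    qed
  qed
qed

lemma invariant_subspace_has_eigenvector:
  fixes A :: "complex^'n^'n"
  assumes "vec.subspace W" and "\<And>w. w \<in> W \<Longrightarrow> A *v w \<in> W" and "u \<in> W" and "u \<noteq> 0"
  shows "\<exists>w\<in>W. w \<noteq> 0 \<and> (\<exists>\<mu>. A *v w = \<mu> *s w)"
proof -
  obtain p where "p \<noteq> 0" "poly_act p A u = 0"
    using exists_annihilating_poly by blast
  then obtain q \<mu> where "poly_act q A u \<noteq> 0" "A *v poly_act q A u = \<mu> *s poly_act q A u"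
    using eigenvector_of_annihilating_poly assms(4) by blast
  moreover have "poly_act q A u \<in> W"
    by (rule poly_act_in_invariant_subspace[OF assms(1-3)])
  ultimately show ?thesis by blast
qed

section \<open>Complexification\<close>

definition cvec :: "real^'n \<Rightarrow> complex^'n" where
  "cvec x = (\<chi> i. complex_of_real (x $ i))"

definition cmat :: "real^'m^'n \<Rightarrow> complex^'m^'n" where
  "cmat A = (\<chi> i j. complex_of_real (A $ i $ j))"

text \<open>The unconjugated pairing, through which complex row vectors act on complexified real
  states (\<open>inner\<close> on \<open>complex^'n\<close> is real-valued).\<close>

definition vdot :: "'a::comm_semiring_1^'n \<Rightarrow> 'a^'n \<Rightarrow> 'a" where
  "vdot u v = (\<Sum>i\<in>UNIV. u $ i * v $ i)"

lemma cvec_0 [simp]: "cvec 0 = 0"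
  by (simp add: cvec_def vec_eq_iff)

lemma cvec_add: "cvec (x + y) = cvec x + cvec y"
  by (simp add: cvec_def vec_eq_iff)

lemma cvec_eq_0_iff: "cvec x = 0 \<longleftrightarrow> x = 0"
  by (simp add: cvec_def vec_eq_iff)

lemma cvec_matrix_vector_mult: "cvec (A *v x) = cmat A *v cvec x"
  by (simp add: cvec_def cmat_def matrix_vector_mult_def vec_eq_iff)

lemma vdot_0_left [simp]: "vdot 0 v = 0"
  by (simp add: vdot_def)

lemma vdot_0_right [simp]: "vdot u 0 = 0"
  by (simp add: vdot_def)

lemma vdot_add_left: "vdot (u + v) w = vdot u w + vdot v w"
  by (simp add: vdot_def distrib_right sum.distrib)

lemma vdot_add_right: "vdot u (v + w) = vdot u v + vdot u w"
  by (simp add: vdot_def distrib_left sum.distrib)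

lemma vdot_scale_left: "vdot (c *s u) v = c * vdot u v"
  by (simp add: vdot_def sum_distrib_left mult.assoc)

lemma vdot_matrix_vector_mult: "vdot u (A *v v) = vdot (u v* A) v"
  unfolding vdot_def matrix_vector_mult_def vector_matrix_mult_def
  by (simp add: sum_distrib_left sum_distrib_right mult.assoc) (rule sum.swap)

lemma vdot_cvec_cvec: "vdot (cvec v) (cvec x) = complex_of_real (v \<bullet> x)"
  by (simp add: vdot_def cvec_def inner_vec_def)

lemma vdot_cvec_axis: "vdot u (cvec (axis i 1)) = u $ i"
  by (simp add: vdot_def cvec_def axis_def if_distrib[of complex_of_real]
      if_distrib[of "\<lambda>x. y * x" for y] cong: if_cong)

lemma vector_matrix_mult_cmat_nth: "(u v* cmat A) $ j = vdot u (cvec (column j A))"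
  by (simp add: vector_matrix_mult_def vdot_def cvec_def cmat_def column_def)

lemma vector_matrix_mult_pbh_matrix_eq_0_iff:
  "c v* pbh_matrix lam D H = 0 \<longleftrightarrow> c v* cmat D = lam *s c \<and> c v* cmat H = 0"
proof -
  have Inl: "(c v* pbh_matrix lam D H) $ Inl j = lam * c $ j - (c v* cmat D) $ j" for j
    by (simp add: vector_matrix_mult_def pbh_matrix_def cmat_def right_diff_distrib
        sum_subtractf mult.commute if_distrib[of "\<lambda>x. y * x" for y] cong: if_cong)
  have Inr: "(c v* pbh_matrix lam D H) $ Inr j = (c v* cmat H) $ j" for j
    by (simp add: vector_matrix_mult_def pbh_matrix_def cmat_def)
  have "c v* pbh_matrix lam D H = 0 \<longleftrightarrow>
      (\<forall>j. (c v* pbh_matrix lam D H) $ Inl j = 0) \<and> (\<forall>j. (c v* pbh_matrix lam D H) $ Inr j = 0)"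
    unfolding vec_eq_iff zero_index by (rule split_sum_all)
  also have "\<dots> \<longleftrightarrow> c v* cmat D = lam *s c \<and> c v* cmat H = 0"
    by (auto simp: Inl Inr vec_eq_iff)
  finally show ?thesis .
qed

section \<open>Necessity\<close>

lemma pbh_rank_if_sparse_controllable:
  fixes D :: "real^'n^'n" and H :: "real^'l^'n"
  assumes "s_sparse_controllable D H s"
  shows "rank (pbh_matrix lam D H) = CARD('n)"
  unfolding rank_eq_card_rows_iff
proof (intro allI impI)
  fix c assume "c v* pbh_matrix lam D H = 0"
  then have cD: "c v* cmat D = lam *s c" and cH: "c v* cmat H = 0"
    by (simp_all add: vector_matrix_mult_pbh_matrix_eq_0_iff)
  have annihilates: "vdot c (cvec (sys_state D H 0 h k)) = 0" for h k
    by (induction k)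
      (simp_all add: cvec_add cvec_matrix_vector_mult vdot_add_right vdot_matrix_vector_mult
        cD cH vdot_scale_left)
  have "c $ i = 0" for i
  proof -
    obtain h K where "sys_state D H 0 h K = axis i 1"
      using assms unfolding s_sparse_controllable_def by blast
    then show ?thesis
      using annihilates[of h K] by (simp add: vdot_cvec_axis)
  qed
  then show "c = 0"
    by (simp add: vec_eq_iff)
qed

lemma matrix_vector_mult_in_span_support_columns:
  fixes H :: "real^'l^'n"
  shows "H *v h \<in> span ((\<lambda>j. column j H) ` {j. h $ j \<noteq> 0})"
proof -
  have "h $ j *\<^sub>R column j H \<in> span ((\<lambda>j. column j H) ` {j. h $ j \<noteq> 0})" for j
    by (cases "h $ j = 0") (simp add: span_zero, intro span_scale span_base imageI, simp)
  then show ?thesis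
    unfolding matrix_mult_sum scalar_mult_eq_scaleR by (rule span_sum)
qed

lemma dim_range_Un_columns_le:
  fixes D :: "real^'n^'n" and H :: "real^'l^'n"
  shows "dim (range ((*v) D) \<union> (\<lambda>j. column j H) ` S) \<le> rank D + card S"
proof -
  have "dim (range ((*v) D) \<union> (\<lambda>j. column j H) ` S) \<le>
      dim (range ((*v) D)) + dim ((\<lambda>j. column j H) ` S)"
    by (rule dim_Un_le)
  also have "\<dots> \<le> rank D + card S"
    using dim_le_card'[of "(\<lambda>j. column j H) ` S"] card_image_le[of S "\<lambda>j. column j H"]
    by (simp add: rank_dim_range)
  finally show ?thesis .
qed

lemma sys_state_from_0_in_span:
  fixes D :: "real^'n^'n" and H :: "real^'l^'n"
  assumes "\<forall>k\<in>{1..K}. l0_norm (h k) \<le> s"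
  shows "\<exists>S. card S \<le> s \<and> sys_state D H 0 h K \<in> span (range ((*v) D) \<union> (\<lambda>j. column j H) ` S)"
proof (cases K)
  case 0
  then show ?thesis
    by (intro exI[of _ "{}"]) (simp add: span_zero)
next
  case (Suc k)
  let ?S = "{j. h K $ j \<noteq> 0}"
  let ?V = "span (range ((*v) D) \<union> (\<lambda>j. column j H) ` ?S)"
  have "card ?S \<le> s"
    using assms Suc by (simp add: l0_norm_def)
  moreover have "D *v sys_state D H 0 h k \<in> ?V"
    by (intro span_base UnI1 rangeI)
  moreover have "span ((\<lambda>j. column j H) ` ?S) \<subseteq> ?V"
    by (intro span_mono Un_upper2)
  then have "H *v h K \<in> ?V"
    by (rule subsetD[OF _ matrix_vector_mult_in_span_support_columns])
  ultimately show ?thesis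
    using Suc by (intro exI[of _ ?S]) (simp add: span_add)
qed

lemma card_le_if_sparse_controllable:
  fixes D :: "real^'n^'n" and H :: "real^'l^'n"
  assumes "s_sparse_controllable D H s"
  shows "CARD('n) \<le> s + rank D"
proof (rule ccontr)
  assume "\<not> CARD('n) \<le> s + rank D"
  define V where "V S = span (range ((*v) D) \<union> (\<lambda>j. column j H) ` S)" for S
  have "finite (V ` {S. card S \<le> s})"
    by (rule finite_imageI[OF finite])
  moreover have "dim T < DIM(real^'n)" if T: "T \<in> V ` {S. card S \<le> s}" for T
  proof -
    obtain S where "card S \<le> s" "T = V S"
      using T by blast
    then show ?thesis
      using dim_range_Un_columns_le[of D H S] \<open>\<not> CARD('n) \<le> s + rank D\<close> by (simp add: V_def)
  qed
  ultimately have "\<Union>(V ` {S. card S \<le> s}) \<noteq> UNIV"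
    by (rule Union_lowdim_ne_UNIV)
  moreover have "x \<in> \<Union>(V ` {S. card S \<le> s})" for x
  proof -
    obtain K h where "\<forall>k\<in>{1..K}. l0_norm (h k) \<le> s" and "sys_state D H 0 h K = x"
      using assms unfolding s_sparse_controllable_def by blast
    then show ?thesis
      using sys_state_from_0_in_span[of K h s D H] by (auto simp: V_def)
  qed
  ultimately show False
    by blast
qed

section \<open>Sufficiency\<close>

definition krylov :: "real^'n^'n \<Rightarrow> real^'l^'n \<Rightarrow> nat \<times> 'l \<Rightarrow> real^'n" where
  "krylov D H = (\<lambda>(m, j). ((*v) D ^^ m) (column j H))"

lemma sys_state_eq_sum:
  "sys_state D H x0 h K = ((*v) D ^^ K) x0 + (\<Sum>m<K. ((*v) D ^^ m) (H *v h (K - m)))"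
proof (induction K)
  case (Suc K)
  then show ?case
    by (simp add: matrix_vector_right_distrib vec.sum sum.lessThan_Suc_shift del: sum.lessThan_Suc)
qed simp

lemma funpow_matrix_vector_mult_eq_sum_krylov:
  "((*v) D ^^ m) (H *v y) = (\<Sum>j\<in>UNIV. y $ j *\<^sub>R krylov D H (m, j))"
proof -
  have "H *v y = (\<Sum>j\<in>UNIV. y $ j *\<^sub>R column j H)"
    by (simp add: matrix_mult_sum scalar_mult_eq_scaleR)
  then show ?thesis
    using linear_funpow[OF matrix_vector_mul_linear[of D], of m]
    by (simp add: linear_sum linear_scale krylov_def)
qed

lemma sum_schedule_eq_sum_krylov:
  assumes "P \<subseteq> {..<K} \<times> UNIV"
  shows "(\<Sum>m<K. ((*v) D ^^ m) (H *v (\<chi> j. if (m, j) \<in> P then c (m, j) else 0))) =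
    (\<Sum>p\<in>P. c p *\<^sub>R krylov D H p)"
proof -
  have "(\<Sum>m<K. ((*v) D ^^ m) (H *v (\<chi> j. if (m, j) \<in> P then c (m, j) else 0))) =
      (\<Sum>p\<in>{..<K} \<times> UNIV. if p \<in> P then c p *\<^sub>R krylov D H p else 0)"
    unfolding funpow_matrix_vector_mult_eq_sum_krylov sum.cartesian_product
    by (intro sum.cong) auto
  also have "\<dots> = (\<Sum>p\<in>P. c p *\<^sub>R krylov D H p)"
    by (simp add: sum.inter_restrict[symmetric] Int_absorb1[OF assms])
  finally show ?thesis .
qed

lemma sparse_controllable_if_spanning_schedule:
  fixes D :: "real^'n^'n" and H :: "real^'l^'n"
  assumes "finite P" and slots: "\<And>m. card {j. (m, j) \<in> P} \<le> s"
    and spans: "span (krylov D H ` P) = UNIV"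
  shows "s_sparse_controllable D H s"
  unfolding s_sparse_controllable_def
proof (intro allI)
  fix x_init x_final :: "real^'n"
  obtain K where "fst ` P \<subseteq> {..<K}"
    using finite_nat_bounded \<open>finite P\<close> by blast
  then have PK: "P \<subseteq> {..<K} \<times> UNIV"
    by force
  obtain c where c: "x_final - ((*v) D ^^ K) x_init = (\<Sum>p\<in>P. c p *\<^sub>R krylov D H p)"
    using span_image_finite_sum[OF \<open>finite P\<close>, of _ "krylov D H"] spans by auto
  text \<open>The input \<open>h k\<close> reaches the final state as \<open>D^(K-k) H h k\<close>, so it carries the
    coefficients of slot \<open>K - k\<close>.\<close>
  define h where "h k = (\<chi> j. if (K - k, j) \<in> P then c (K - k, j) else 0)" for k
  have "l0_norm (h k) \<le> s" for k
  proof -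
    have "l0_norm (h k) \<le> card {j. (K - k, j) \<in> P}"
      unfolding l0_norm_def by (rule card_mono[OF finite]) (auto simp: h_def)
    then show ?thesis
      using slots[of "K - k"] by linarith
  qed
  moreover have "sys_state D H x_init h K = x_final"
  proof -
    have "(\<Sum>m<K. ((*v) D ^^ m) (H *v h (K - m))) =
        (\<Sum>m<K. ((*v) D ^^ m) (H *v (\<chi> j. if (m, j) \<in> P then c (m, j) else 0)))"
      by (intro sum.cong) (simp_all add: h_def cong: if_cong)
    also have "\<dots> = (\<Sum>p\<in>P. c p *\<^sub>R krylov D H p)"
      by (rule sum_schedule_eq_sum_krylov[OF PK])
    finally show ?thesis
      using c by (simp add: sys_state_eq_sum algebra_simps)
  qed
  ultimately show "\<exists>K h. (\<forall>k\<in>{1..K}. l0_norm (h k) \<le> s) \<and> sys_state D H x_init h K = x_final"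
    by blast
qed

lemma funpow_image_range_krylov:
  "((*v) D ^^ k) ` range (krylov D H) = krylov D H ` ({k..} \<times> UNIV)"
proof -
  have shift: "((*v) D ^^ k) (krylov D H (m, j)) = krylov D H (k + m, j)" for m j
    by (simp add: krylov_def funpow_add)
  show ?thesis
  proof
    show "((*v) D ^^ k) ` range (krylov D H) \<subseteq> krylov D H ` ({k..} \<times> UNIV)"
    proof (rule image_subsetI)
      fix x assume "x \<in> range (krylov D H)"
      then obtain m j where "x = krylov D H (m, j)"
        by (metis rangeE surj_pair)
      then have "((*v) D ^^ k) x = krylov D H (k + m, j)"
        by (simp add: shift)
      then show "((*v) D ^^ k) x \<in> krylov D H ` ({k..} \<times> UNIV)"
        by (rule image_eqI) simp
    qed
    show "krylov D H ` ({k..} \<times> UNIV) \<subseteq> ((*v) D ^^ k) ` range (krylov D H)"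
    proof
      fix x assume "x \<in> krylov D H ` ({k..} \<times> UNIV)"
      then obtain m j where "k \<le> m" "x = krylov D H (m, j)"
        by blast
      then have "x = ((*v) D ^^ k) (krylov D H (m - k, j))"
        by (simp add: shift)
      then show "x \<in> ((*v) D ^^ k) ` range (krylov D H)"
        by blast
    qed
  qed
qed

lemma matrix_vector_mult_in_span_krylov:
  assumes "x \<in> span (range (krylov D H))"
  shows "D *v x \<in> span (range (krylov D H))"
proof -
  have "(*v) D ` range (krylov D H) = krylov D H ` ({1..} \<times> UNIV)"
    using funpow_image_range_krylov[where k = 1] by simp
  then have "span ((*v) D ` range (krylov D H)) \<subseteq> span (range (krylov D H))"
    by (intro span_mono) auto
  then show ?thesis
    using assms by (auto simp: span_linear_image)
qed

lemma span_krylov_eq_UNIV_if_pbh_rank: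
  fixes D :: "real^'n^'n" and H :: "real^'l^'n"
  assumes pbh: "\<And>lam. rank (pbh_matrix lam D H) = CARD('n)"
  shows "span (range (krylov D H)) = UNIV"
proof (rule ccontr)
  let ?K = "span (range (krylov D H))"
  assume "?K \<noteq> UNIV"
  then have "dim ?K < DIM(real^'n)"
    using dim_eq_full[of ?K] dim_subset_UNIV[of ?K] by (simp add: span_span)
  then obtain v where v: "v \<noteq> 0" "\<And>x. x \<in> span ?K \<Longrightarrow> orthogonal v x"
    by (rule orthogonal_to_subspace_exists) blast
  define W where "W = {u. \<forall>x\<in>?K. vdot u (cvec x) = 0}"
  have "vec.subspace W"
    by (auto simp: vec.subspace_def W_def vdot_add_left vdot_scale_left)
  moreover have "transpose (cmat D) *v u \<in> W" if "u \<in> W" for u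
    using that matrix_vector_mult_in_span_krylov[where D = D and H = H]
    by (simp add: W_def flip: vdot_matrix_vector_mult cvec_matrix_vector_mult)
  moreover have "cvec v \<in> W" "cvec v \<noteq> 0"
    using v by (simp_all add: W_def vdot_cvec_cvec cvec_eq_0_iff orthogonal_def span_span)
  ultimately obtain w \<mu> where w: "w \<in> W" "w \<noteq> 0" "w v* cmat D = \<mu> *s w"
    using invariant_subspace_has_eigenvector[of W "transpose (cmat D)" "cvec v"] by auto
  have "column j H \<in> ?K" for j
  proof (rule span_base)
    show "column j H \<in> range (krylov D H)"
      by (rule image_eqI[of _ _ "(0, j)"]) (simp_all add: krylov_def)
  qed
  then have "w v* cmat H = 0"
    using w(1) by (simp add: W_def vec_eq_iff vector_matrix_mult_cmat_nth)
  then have "w v* pbh_matrix \<mu> D H = 0"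
    using w(3) by (simp add: vector_matrix_mult_pbh_matrix_eq_0_iff)
  then show False
    using pbh[of \<mu>] w(2) rank_eq_card_rows_iff by blast
qed

lemma range_funpow_eq_span_krylov:
  assumes "span (range (krylov D H)) = UNIV"
  shows "range ((*v) D ^^ k) = span (krylov D H ` ({k..} \<times> UNIV))"
proof -
  have "range ((*v) D ^^ k) = ((*v) D ^^ k) ` span (range (krylov D H))"
    by (simp add: assms)
  also have "\<dots> = span (((*v) D ^^ k) ` range (krylov D H))"
    by (rule span_linear_image[symmetric, OF linear_funpow[OF matrix_vector_mul_linear]])
  finally show ?thesis
    by (simp only: funpow_image_range_krylov)
qed

lemma span_krylov_prefix_and_range_funpow:
  assumes "span (range ((*v) D) \<union> (\<lambda>j. column j H) ` T) = UNIV"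
  shows "span (krylov D H ` ({..<k} \<times> T) \<union> range ((*v) D ^^ k)) = UNIV"
proof (induction k)
  case 0
  then show ?case by simp
next
  case (Suc k)
  let ?S = "krylov D H ` ({..<Suc k} \<times> T) \<union> range ((*v) D ^^ Suc k)"
  have "((*v) D ^^ k) ` (range ((*v) D) \<union> (\<lambda>j. column j H) ` T) \<subseteq> ?S"
  proof
    fix y assume "y \<in> ((*v) D ^^ k) ` (range ((*v) D) \<union> (\<lambda>j. column j H) ` T)"
    then consider x where "y = ((*v) D ^^ k) (D *v x)"
      | j where "j \<in> T" "y = ((*v) D ^^ k) (column j H)"
      by blast
    then show "y \<in> ?S"
    proof cases
      case 1
      then have "y = ((*v) D ^^ Suc k) x"
        by (simp only: funpow_Suc_right comp_apply)
      then show ?thesis by blast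
    next
      case 2
      then have "y = krylov D H (k, j)"
        by (simp add: krylov_def)
      moreover have "(k, j) \<in> {..<Suc k} \<times> T"
        using \<open>j \<in> T\<close> by simp
      ultimately show ?thesis
        by blast
    qed
  qed
  then have "span (((*v) D ^^ k) ` (range ((*v) D) \<union> (\<lambda>j. column j H) ` T)) \<subseteq> span ?S"
    by (rule span_mono)
  moreover have "span (((*v) D ^^ k) ` (range ((*v) D) \<union> (\<lambda>j. column j H) ` T)) =
      range ((*v) D ^^ k)"
    using span_linear_image[OF linear_funpow[OF matrix_vector_mul_linear[of D], of k]] assms by simp
  ultimately have "range ((*v) D ^^ k) \<subseteq> span ?S"
    by simp
  moreover have "krylov D H ` ({..<k} \<times> T) \<subseteq> ?S"
    by auto
  then have "krylov D H ` ({..<k} \<times> T) \<subseteq> span ?S"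
    by (rule order_trans[OF _ span_superset])
  ultimately have "krylov D H ` ({..<k} \<times> T) \<union> range ((*v) D ^^ k) \<subseteq> span ?S"
    by (rule Un_least[rotated])
  then show ?case
    by (rule span_eq_UNIV_if_subset_span[OF Suc.IH])
qed

lemma spanning_columns_exist:
  fixes D :: "real^'n^'n" and H :: "real^'l^'n"
  assumes kalman: "span (range (krylov D H)) = UNIV" and "CARD('n) \<le> s + rank D"
  shows "\<exists>T. card T \<le> s \<and> span (range ((*v) D) \<union> (\<lambda>j. column j H) ` T) = UNIV"
proof -
  let ?L = "(*v) D" and ?col = "\<lambda>j. column j H"
  have "range (krylov D H) \<subseteq> range ?L \<union> range ?col"
  proof
    fix x assume "x \<in> range (krylov D H)"
    then obtain m j where "x = krylov D H (m, j)"
      by (metis rangeE surj_pair)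
    then show "x \<in> range ?L \<union> range ?col"
      by (cases m) (auto simp: krylov_def)
  qed
  then have "range (krylov D H) \<subseteq> span (range ?L \<union> range ?col)"
    by (rule order_trans[OF _ span_superset])
  then have "span (range ?L \<union> range ?col) = UNIV"
    by (rule span_eq_UNIV_if_subset_span[OF kalman])
  moreover have "subspace (range ?L)"
    by (rule linear_subspace_image[OF matrix_vector_mul_linear subspace_UNIV])
  ultimately obtain F where F: "F \<subseteq> range ?col" "card F + dim (range ?L) \<le> CARD('n)"
      "span (range ?L \<union> F) = UNIV"
    using spanning_extension_card_le[of "range ?L" "range ?col"] by auto
  then obtain T where T: "inj_on ?col T" "F = ?col ` T"
    using subset_image_inj[of F ?col UNIV] by blast
  have "card T \<le> s"
    using F(2) assms(2) card_image[OF T(1)] T(2) by (simp add: rank_dim_range)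
  then show ?thesis
    using F(3) T(2) by blast
qed

lemma stable_range_in_span_krylov_tails:
  assumes kalman: "span (range (krylov D H)) = UNIV"
  shows "\<exists>k0. \<forall>E. range ((*v) D ^^ k0) \<subseteq> span (krylov D H ` ({E..} \<times> UNIV))"
proof -
  obtain k0 where k0: "\<And>k. k0 \<le> k \<Longrightarrow> range ((*v) D ^^ k) = range ((*v) D ^^ k0)"
    using range_funpow_stabilizes[OF matrix_vector_mul_linear] by blast
  have "range ((*v) D ^^ k0) \<subseteq> span (krylov D H ` ({E..} \<times> UNIV))" for E
  proof -
    have "range ((*v) D ^^ k0) = span (krylov D H ` ({max E k0..} \<times> UNIV))"
      using k0[of "max E k0"] range_funpow_eq_span_krylov[OF kalman] by simp
    also have "\<dots> \<subseteq> span (krylov D H ` ({E..} \<times> UNIV))"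
      by (intro span_mono image_mono) auto
    finally show ?thesis .
  qed
  then show ?thesis by blast
qed

lemma sparse_spanning_schedule_exists:
  fixes D :: "real^'n^'n" and H :: "real^'l^'n"
  assumes kalman: "span (range (krylov D H)) = UNIV" and "1 \<le> s" and "CARD('n) \<le> s + rank D"
  shows "\<exists>P. finite P \<and> (\<forall>m. card {j. (m, j) \<in> P} \<le> s) \<and> span (krylov D H ` P) = UNIV"
proof -
  obtain T where T: "card T \<le> s" "span (range ((*v) D) \<union> (\<lambda>j. column j H) ` T) = UNIV"
    using spanning_columns_exist[OF kalman assms(3)] by blast
  obtain k0 where tails: "\<And>E. range ((*v) D ^^ k0) \<subseteq> span (krylov D H ` ({E..} \<times> UNIV))"
    using stable_range_in_span_krylov_tails[OF kalman] by blast
  obtain Q where Q: "finite Q" "fst ` Q \<subseteq> {k0..}" "inj_on fst Q"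
      "range ((*v) D ^^ k0) \<subseteq> span (krylov D H ` ({..<k0} \<times> T) \<union> krylov D H ` Q)"
    using slotwise_spanning_extension[of "range ((*v) D ^^ k0)" "krylov D H" k0
        "krylov D H ` ({..<k0} \<times> T)", OF tails] by blast
  define P where "P = {..<k0} \<times> T \<union> Q"
  have "finite P"
    using Q(1) by (simp add: P_def)
  moreover have "card {j. (m, j) \<in> P} \<le> s" for m
  proof (cases "m < k0")
    case True
    then have "{j. (m, j) \<in> P} = T"
      using Q(2) by (force simp: P_def)
    then show ?thesis
      using T(1) by simp
  next
    case False
    then have "{j. (m, j) \<in> P} = {j. (m, j) \<in> Q}"
      by (auto simp: P_def)
    then show ?thesis
      using card_slice_le_Suc0[OF Q(3), of m] assms(2) by simp
  qed
  moreover have "span (krylov D H ` P) = UNIV"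
  proof (rule span_eq_UNIV_if_subset_span)
    show "span (krylov D H ` ({..<k0} \<times> T) \<union> range ((*v) D ^^ k0)) = UNIV"
      by (rule span_krylov_prefix_and_range_funpow[OF T(2)])
    have "krylov D H ` ({..<k0} \<times> T) \<subseteq> krylov D H ` P"
      by (auto simp: P_def)
    then have "krylov D H ` ({..<k0} \<times> T) \<subseteq> span (krylov D H ` P)"
      by (rule order_trans[OF _ span_superset])
    moreover have "range ((*v) D ^^ k0) \<subseteq> span (krylov D H ` P)"
      using Q(4) by (simp add: P_def image_Un)
    ultimately show "krylov D H ` ({..<k0} \<times> T) \<union> range ((*v) D ^^ k0) \<subseteq> span (krylov D H ` P)"
      by (rule Un_least)
  qed
  ultimately show ?thesis by blast
qed

theorem theorem1:
  fixes D :: "real^'n^'n" and H :: "real^'l^'n" and s :: nat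
  assumes "1 \<le> s" and "s \<le> CARD('l)"
  shows "s_sparse_controllable D H s \<longleftrightarrow>
           ((\<forall>lam::complex. rank (pbh_matrix lam D H) = CARD('n)) \<and>
            CARD('n) \<le> s + rank D)"
proof
  assume "s_sparse_controllable D H s"
  then show "(\<forall>lam::complex. rank (pbh_matrix lam D H) = CARD('n)) \<and> CARD('n) \<le> s + rank D"
    using pbh_rank_if_sparse_controllable card_le_if_sparse_controllable by blast
next
  assume "(\<forall>lam::complex. rank (pbh_matrix lam D H) = CARD('n)) \<and> CARD('n) \<le> s + rank D"
  then have pbh: "\<And>lam. rank (pbh_matrix lam D H) = CARD('n)" and rank: "CARD('n) \<le> s + rank D"
    by simp_all
  from sparse_spanning_schedule_exists[OF span_krylov_eq_UNIV_if_pbh_rank[OF pbh] assms(1) rank]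
  obtain P where "finite P" "\<And>m. card {j. (m, j) \<in> P} \<le> s" "span (krylov D H ` P) = UNIV"
    by blast
  then show "s_sparse_controllable D H s"
    by (rule sparse_controllable_if_spanning_schedule)
qed

end
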